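(* Let $\mathbf{Z}$ be a non-empty measurable space and $N\ge1$. For any event (measurable set) $A\subseteq\mathbf{Z}^N$, \[ \mathbb{P}^{\mathrm{exch}}(A)\le\mathbb{P}^{\mathrm{ce}}(A). \] If moreover $\mathbf{Z}=\{0,1\}$, then for any $A\subseteq\mathbf{Z}^N$, \[ \mathbb{P}^{\mathrm{ce}}(A)\le N\,\mathbb{P}^{\mathrm{exch}}(A). \]
   Context: For a set $X$, $X^+:=\bigcup_{n=1}^\infty X^n$ is the set of non-empty finite sequences of elements of $X$ (a measurable space if $X$ is). A nonconformity e-measure is a measurable function $B:\mathbf{Z}^+\to[0,\infty)^+$ mapping every finite sequence $(z_1,\dots,z_m)$, $m\ge1$, to a sequence $(\alpha_1,\dots,\alpha_m)$ of the same length such that (i) $\frac1m\sum_{i=1}^m\alpha_i\le1$, and (ii) (equivariance) for any $m$ and any permutation $\pi$ of $\{1,\dots,m\}$, if $(\alpha_1,\dots,\alpha_m)=B(z_1,\dots,z_m)$ then $(\alpha_{\pi(1)},\dots,\alpha_{\pi(m)})=B(z_{\pi(1)},\dots,z_{\pi(m)})$. The corresponding conformal e-predictor is $f:\mathbf{Z}^+\to[0,\infty)$, $f(z_1,\dots,z_m):=\alpha_m$ where $(\alpha_1,\dots,\alpha_m)=B(z_1,\dots,z_m)$. A function $E:\mathbf{Z}^N\to[0,\infty)$ is a basic conformal e-test if, for some conformal e-predictor $f$, $E(z_1,\dots,z_N)=\prod_{n=1}^N f(z_1,\dots,z_n)$ for all $(z_1,\dots,z_N)\in\mathbf{Z}^N$.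 A conformal e-test is a finite convex combination $\lambda_1E^{(1)}+\dots+\lambda_kE^{(k)}$ of basic conformal e-tests, where $k\in\{1,2,\dots\}$, $\lambda_i\in[0,1]$, $\lambda_1+\dots+\lambda_k=1$. The upper exchangeability probability of measurable $A\subseteq\mathbf{Z}^N$ is $\mathbb{P}^{\mathrm{exch}}(A):=\sup_P P(A)$, with $P$ ranging over the exchangeable (permutation-invariant) probability measures on $\mathbf{Z}^N$. The upper conformal e-probability of $A\subseteq\mathbf{Z}^N$ is \[ \mathbb{P}^{\mathrm{ce}}(A):=\inf\{\alpha>0:\ \exists E\ \forall(z_1,\dots,z_N)\in A:\ E(z_1,\dots,z_N)\ge1/\alpha\}, \] with $E$ ranging over the conformal e-tests on $\mathbf{Z}^N$. When $\mathbf{Z}=\{0,1\}$ it carries the discrete $\sigma$-algebra. *)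

theory Defs
  imports "HOL-Probability.Probability"
begin

text \<open>
  Finite sequences \<open>(z\<^sub>1, \<dots>, z\<^sub>m)\<close> are indexed from 0, as points of the finite product
  measurable space below; only \<open>space M\<close> and \<open>sets M\<close> matter.
\<close>

abbreviation seqs :: "'a measure \<Rightarrow> nat \<Rightarrow> (nat \<Rightarrow> 'a) measure" where
  "seqs M m \<equiv> \<Pi>\<^sub>M i\<in>{..<m}. M"

definition permute_seq :: "nat \<Rightarrow> (nat \<Rightarrow> nat) \<Rightarrow> (nat \<Rightarrow> 'b) \<Rightarrow> nat \<Rightarrow> 'b" where
  "permute_seq m \<pi> z = (\<lambda>i\<in>{..<m}. z (\<pi> i))"

text \<open>
  The space of nonempty finite sequences is the disjoint union of the spaces \<open>seqs M m\<close>,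
  \<open>m \<ge> 1\<close>. A length-preserving map on it is a family \<open>B m\<close> of maps, one for each length
  \<open>m \<ge> 1\<close>, and it is measurable iff every \<open>B m\<close> is; \<open>B 0\<close> is irrelevant.
  The codomain of \<open>B m\<close> below is the \<open>m\<close>-th power of \<open>[0, \<infinity>)\<close>, so nonnegativity is included.
\<close>

definition nonconformity_e_measure ::
    "'a measure \<Rightarrow> (nat \<Rightarrow> (nat \<Rightarrow> 'a) \<Rightarrow> nat \<Rightarrow> real) \<Rightarrow> bool" where
  "nonconformity_e_measure M B \<longleftrightarrow>
     (\<forall>m\<ge>1.
        B m \<in> seqs M m \<rightarrow>\<^sub>M seqs (restrict_space borel {0..}) m \<and>
        (\<forall>z\<in>space (seqs M m). (1 / real m) * (\<Sum>i<m. B m z i) \<le> 1) \<and>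
        (\<forall>z\<in>space (seqs M m). \<forall>\<pi>. \<pi> permutes {..<m} \<longrightarrow>
           B m (permute_seq m \<pi> z) = permute_seq m \<pi> (B m z)))"

definition conformal_e_predictor ::
    "'a measure \<Rightarrow> (nat \<Rightarrow> (nat \<Rightarrow> 'a) \<Rightarrow> real) \<Rightarrow> bool" where
  "conformal_e_predictor M f \<longleftrightarrow>
     (\<exists>B. nonconformity_e_measure M B \<and>
          (\<forall>m\<ge>1. \<forall>z\<in>space (seqs M m). f m z = B m z (m - 1)))"

definition basic_conformal_e_test :: "'a measure \<Rightarrow> nat \<Rightarrow> ((nat \<Rightarrow> 'a) \<Rightarrow> real) \<Rightarrow> bool" where
  "basic_conformal_e_test M N E \<longleftrightarrow>
     (\<exists>f. conformal_e_predictor M f \<and>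
          (\<forall>z\<in>space (seqs M N). E z = (\<Prod>n=1..N. f n (restrict z {..<n}))))"

definition conformal_e_test :: "'a measure \<Rightarrow> nat \<Rightarrow> ((nat \<Rightarrow> 'a) \<Rightarrow> real) \<Rightarrow> bool" where
  "conformal_e_test M N E \<longleftrightarrow>
     (\<exists>(k::nat) (w :: nat \<Rightarrow> real) F.
        k \<ge> 1 \<and>
        (\<forall>i\<in>{1..k}. w i \<in> {0..1} \<and> basic_conformal_e_test M N (F i)) \<and>
        (\<Sum>i=1..k. w i) = 1 \<and>
        (\<forall>z\<in>space (seqs M N). E z = (\<Sum>i=1..k. w i * F i z)))"

definition exchangeable :: "'a measure \<Rightarrow> nat \<Rightarrow> (nat \<Rightarrow> 'a) measure \<Rightarrow> bool" where
  "exchangeable M N P \<longleftrightarrow>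
     prob_space P \<and> sets P = sets (seqs M N) \<and>
     (\<forall>\<pi>. \<pi> permutes {..<N} \<longrightarrow> distr P (seqs M N) (permute_seq N \<pi>) = P)"

text \<open>
  Both bounds are taken in the reals. For \<open>space M \<noteq> {}\<close> the supremum is over a nonempty set
  (point masses at constant sequences are exchangeable) bounded by 1, and the infimum is over a
  set bounded below by 0 that contains 1 (take the constant test 1).
\<close>

definition upper_exch_prob :: "'a measure \<Rightarrow> nat \<Rightarrow> (nat \<Rightarrow> 'a) set \<Rightarrow> real" where
  "upper_exch_prob M N A = (SUP P\<in>{P. exchangeable M N P}. measure P A)"

definition upper_ce_prob :: "'a measure \<Rightarrow> nat \<Rightarrow> (nat \<Rightarrow> 'a) set \<Rightarrow> real" where
  "upper_ce_prob M N A =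
     Inf {\<alpha>. \<alpha> > 0 \<and> (\<exists>E. conformal_e_test M N E \<and> (\<forall>z\<in>A. E z \<ge> 1 / \<alpha>))}"

end

theory Submission
  imports Defs
begin

text \<open>
  Lower bound: the average of a basic conformal e-test over all permutations of a fixed
  sequence is at most 1, because equivariance turns the last factor into \<open>B N z (\<pi> (N - 1))\<close>,
  which depends only on the element moved to the last place, and induction bounds the rest.
  Hence if \<open>E \<ge> 1 / \<alpha>\<close> on \<open>A\<close>, at most a fraction \<open>\<alpha>\<close> of the permutations of any sequence
  lies in \<open>A\<close>, and integrating this against an exchangeable \<open>P\<close> gives \<open>P A \<le> \<alpha>\<close>.

  Upper bound: for a binary sequence \<open>a\<close> with \<open>k\<close> ones, the test that at each step bets
  everything on the next symbol of \<open>a\<close> attains \<open>N choose k\<close> at \<open>a\<close>. If \<open>p\<close> is the upper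
  exchangeability probability of \<open>A\<close>, then \<open>A\<close> has at most \<open>p * (N choose k)\<close> elements with
  \<open>k\<close> ones, so the weights \<open>1 / (N * p * (N choose k))\<close> add up to at most 1 over \<open>A\<close>, provided
  that only \<open>N\<close> of the \<open>N + 1\<close> values of \<open>k\<close> occur. If the zero sequence is in \<open>A\<close>, then
  \<open>p = 1\<close> and nothing is to be proved.
\<close>

section \<open>Permuted sequences and elementary bounds for nonconformity e-measures\<close>

lemma permute_seq_in_space:
  assumes "z \<in> space (seqs M n)" "\<And>i. i < m \<Longrightarrow> \<pi> i < n"
  shows "permute_seq m \<pi> z \<in> space (seqs M m)"
  using assms by (auto simp: permute_seq_def space_PiM)

lemma measurable_permute_seq:
  assumes "\<pi> permutes {..<N}"
  shows "permute_seq N \<pi> \<in> seqs M N \<rightarrow>\<^sub>M seqs M N"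
proof -
  have "\<pi> i \<in> {..<N}" if "i < N" for i
    using permutes_in_image[OF assms] that by blast
  then show ?thesis
    unfolding permute_seq_def
    by (intro measurable_restrict measurable_component_singleton) auto
qed

lemma nonconformity_e_measure_nonneg:
  assumes "nonconformity_e_measure M B" "z \<in> space (seqs M m)" "i < m"
  shows "B m z i \<ge> 0"
proof -
  have "B m \<in> seqs M m \<rightarrow>\<^sub>M seqs (restrict_space borel {0..}) m"
    using assms by (auto simp: nonconformity_e_measure_def)
  then have "B m z \<in> space (seqs (restrict_space borel {0..}) m)"
    using assms(2) by (rule measurable_space)
  then show ?thesis
    using assms(3) by (auto simp: space_PiM space_restrict_space PiE_iff)
qed

lemma nonconformity_e_measure_sum_le:
  assumes "nonconformity_e_measure M B" "z \<in> space (seqs M m)" "m \<ge> 1"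
  shows "(\<Sum>i<m. B m z i) \<le> real m"
proof -
  have "(1 / real m) * (\<Sum>i<m. B m z i) \<le> 1"
    using assms by (auto simp: nonconformity_e_measure_def)
  then show ?thesis
    using assms(3) by (simp add: field_simps)
qed

lemma nonconformity_e_measure_equivariant:
  assumes "nonconformity_e_measure M B" "z \<in> space (seqs M m)" "m \<ge> 1" "\<pi> permutes {..<m}"
  shows "B m (permute_seq m \<pi> z) = permute_seq m \<pi> (B m z)"
  using assms by (auto simp: nonconformity_e_measure_def)

lemma conformal_e_predictor_nonneg:
  assumes "conformal_e_predictor M f" "z \<in> space (seqs M m)" "m \<ge> 1"
  shows "f m z \<ge> 0"
  using assms nonconformity_e_measure_nonneg[of M _ z m "m - 1"]
  by (fastforce simp: conformal_e_predictor_def)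

section \<open>Permutation averages of conformal e-tests\<close>

lemma restrict_in_space_seqs:
  assumes "z \<in> space (seqs M N)" "n \<le> N"
  shows "restrict z {..<n} \<in> space (seqs M n)"
  using assms by (auto simp: space_PiM PiE_iff)

lemma sum_permutations_prod_predictor_le:
  assumes f: "conformal_e_predictor M f" and "z \<in> space (seqs M N)"
  shows "(\<Sum>\<pi> | \<pi> permutes {..<N}.
            \<Prod>n=1..N. f n (restrict (permute_seq N \<pi> z) {..<n})) \<le> fact N"
  using assms(2)
\<comment> \<open>The sequence has to vary: the step from \<open>N\<close> to \<open>Suc N\<close>
  uses the claim for \<open>Suc N\<close> shorter sequences, one for each entry of \<open>z\<close>
  that can be moved to the last place.\<close>
proof (induction N arbitrary: z)
  case 0
  then show ?case by simp
next
  case (Suc N)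
  obtain B where B: "nonconformity_e_measure M B"
    and fB: "\<And>m z. m \<ge> 1 \<Longrightarrow> z \<in> space (seqs M m) \<Longrightarrow> f m z = B m z (m - 1)"
    using f by (auto simp: conformal_e_predictor_def)
  let ?g = "\<lambda>\<pi>. \<Prod>n=1..Suc N. f n (restrict (permute_seq (Suc N) \<pi> z) {..<n})"
  \<comment> \<open>On its first \<open>N\<close> places, \<open>z\<close> composed with the
    transposition is \<open>z\<close> with entry \<open>b\<close> removed and entry \<open>N\<close>
    put in its slot. \<open>?h b q\<close> is the product of the first \<open>N\<close> factors
    along the rearrangement of this shorter sequence by \<open>q\<close>.\<close>
  let ?h = "\<lambda>b q. \<Prod>n=1..N. f n (restrict (permute_seq N q
                    (permute_seq N (Transposition.transpose N b) z)) {..<n})"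
  have ins: "{..<Suc N} = insert N {..<N}" by auto
  \<comment> \<open>Each permutation of \<open>Suc N\<close> places is uniquely a permutation
    \<open>q\<close> of the first \<open>N\<close> places followed by the transposition of
    \<open>N\<close> and \<open>b\<close>, where \<open>b\<close> is the image of \<open>N\<close>.
    The last factor sees only \<open>b\<close>, the earlier ones only the shorter sequence.\<close>
  have split: "?g (Transposition.transpose N b \<circ> q) = ?h b q * B (Suc N) z b"
    if b: "b \<in> insert N {..<N}" and q: "q permutes {..<N}" for b q
  proof -
    let ?\<pi> = "Transposition.transpose N b \<circ> q"
    have "q permutes insert N {..<N}"
      using q by (rule permutes_subset) auto
    moreover have "Transposition.transpose N b permutes insert N {..<N}"
      using b by (intro permutes_swap_id) auto
    ultimately have \<pi>: "?\<pi> permutes {..<Suc N}"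
      unfolding ins by (rule permutes_compose)
    have qN: "q N = N"
      using q by (simp add: permutes_not_in)
    have in_space: "permute_seq (Suc N) ?\<pi> z \<in> space (seqs M (Suc N))"
      using Suc.prems permutes_in_image[OF \<pi>]
      by (intro permute_seq_in_space[where n = "Suc N"]) (metis lessThan_iff)+
    have "restrict (permute_seq (Suc N) ?\<pi> z) {..<Suc N} = permute_seq (Suc N) ?\<pi> z"
      by (auto simp: permute_seq_def)
    then have "f (Suc N) (restrict (permute_seq (Suc N) ?\<pi> z) {..<Suc N}) =
        B (Suc N) (permute_seq (Suc N) ?\<pi> z) N"
      using fB[OF _ in_space] by simp
    also have "\<dots> = permute_seq (Suc N) ?\<pi> (B (Suc N) z) N"
      using nonconformity_e_measure_equivariant[OF B Suc.prems _ \<pi>] by simp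
    also have "\<dots> = B (Suc N) z b"
      by (simp add: permute_seq_def qN)
    finally have last: "f (Suc N) (restrict (permute_seq (Suc N) ?\<pi> z) {..<Suc N}) =
        B (Suc N) z b" .
    have "restrict (permute_seq (Suc N) ?\<pi> z) {..<n} =
        restrict (permute_seq N q (permute_seq N (Transposition.transpose N b) z)) {..<n}" if "n \<le> N" for n
    proof -
      have "q i < N" if "i < n" for i
        using permutes_in_image[OF q, of i] that \<open>n \<le> N\<close> by auto
      then show ?thesis
        using that by (auto simp: permute_seq_def fun_eq_iff)
    qed
    then have "(\<Prod>n=1..N. f n (restrict (permute_seq (Suc N) ?\<pi> z) {..<n})) = ?h b q"
      by (intro prod.cong) auto
    then show ?thesis
      using last by (simp del: restrict_apply)
  qed
  have nonneg: "B (Suc N) z b \<ge> 0" if "b \<in> insert N {..<N}" for b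
    using nonconformity_e_measure_nonneg[OF B Suc.prems] that by auto
  have IH: "(\<Sum>q | q permutes {..<N}. ?h b q) \<le> fact N" if "b \<in> insert N {..<N}" for b
    using that Suc.prems
    by (intro Suc.IH permute_seq_in_space[where n = "Suc N"]) (auto simp: Transposition.transpose_def)
  have "(\<Sum>\<pi> | \<pi> permutes {..<Suc N}. ?g \<pi>) =
      (\<Sum>b\<in>insert N {..<N}. \<Sum>q | q permutes {..<N}. ?g (Transposition.transpose N b \<circ> q))"
    unfolding ins by (rule sum_over_permutations_insert) auto
  also have "\<dots> = (\<Sum>b\<in>insert N {..<N}. B (Suc N) z b * (\<Sum>q | q permutes {..<N}. ?h b q))"
  proof (intro sum.cong refl)
    fix b assume "b \<in> insert N {..<N}"
    then have "(\<Sum>q | q permutes {..<N}. ?g (Transposition.transpose N b \<circ> q)) =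
        (\<Sum>q | q permutes {..<N}. ?h b q * B (Suc N) z b)"
      by (intro sum.cong refl split) auto
    also have "\<dots> = B (Suc N) z b * (\<Sum>q | q permutes {..<N}. ?h b q)"
      by (simp only: sum_distrib_left mult.commute)
    finally show "(\<Sum>q | q permutes {..<N}. ?g (Transposition.transpose N b \<circ> q)) =
        B (Suc N) z b * (\<Sum>q | q permutes {..<N}. ?h b q)" .
  qed
  also have "\<dots> \<le> (\<Sum>b\<in>insert N {..<N}. B (Suc N) z b * fact N)"
    using nonneg IH by (intro sum_mono mult_left_mono) auto
  also have "\<dots> = (\<Sum>b<Suc N. B (Suc N) z b) * fact N"
    unfolding ins by (rule sum_distrib_right[symmetric])
  also have "\<dots> \<le> real (Suc N) * fact N"
    using nonconformity_e_measure_sum_le[OF B Suc.prems] by (intro mult_right_mono) auto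
  finally show ?case
    unfolding fact_Suc .
qed

lemma basic_conformal_e_test_nonneg:
  assumes "basic_conformal_e_test M N E" "z \<in> space (seqs M N)"
  shows "E z \<ge> 0"
proof -
  obtain f where f: "conformal_e_predictor M f"
    and E: "E z = (\<Prod>n=1..N. f n (restrict z {..<n}))"
    using assms by (auto simp: basic_conformal_e_test_def)
  have "f n (restrict z {..<n}) \<ge> 0" if "n \<in> {1..N}" for n
    using that assms(2) restrict_in_space_seqs
    by (intro conformal_e_predictor_nonneg[OF f]) auto
  then show ?thesis
    unfolding E by (rule prod_nonneg)
qed

lemma conformal_e_test_nonneg:
  assumes "conformal_e_test M N E" "z \<in> space (seqs M N)"
  shows "E z \<ge> 0"
proof -
  obtain k :: nat and w and F :: "nat \<Rightarrow> (nat \<Rightarrow> 'a) \<Rightarrow> real"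
    where F: "\<And>i. i \<in> {1..k} \<Longrightarrow> w i \<in> {0..1} \<and> basic_conformal_e_test M N (F i)"
    and E: "E z = (\<Sum>i=1..k. w i * F i z)"
    using assms unfolding conformal_e_test_def by blast
  show ?thesis
    unfolding E using F basic_conformal_e_test_nonneg[OF _ assms(2)]
    by (intro sum_nonneg mult_nonneg_nonneg) auto
qed

lemma sum_permutations_basic_conformal_e_test_le:
  assumes "basic_conformal_e_test M N E" "z \<in> space (seqs M N)"
  shows "(\<Sum>\<pi> | \<pi> permutes {..<N}. E (permute_seq N \<pi> z)) \<le> fact N"
proof -
  obtain f where f: "conformal_e_predictor M f"
    and E: "\<And>z. z \<in> space (seqs M N) \<Longrightarrow> E z = (\<Prod>n=1..N. f n (restrict z {..<n}))"
    using assms by (auto simp: basic_conformal_e_test_def)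
  have "(\<Sum>\<pi> | \<pi> permutes {..<N}. E (permute_seq N \<pi> z)) =
      (\<Sum>\<pi> | \<pi> permutes {..<N}. \<Prod>n=1..N. f n (restrict (permute_seq N \<pi> z) {..<n}))"
    using assms(2) measurable_space[OF measurable_permute_seq]
    by (intro sum.cong refl E) blast
  also have "\<dots> \<le> fact N"
    using f assms(2) by (rule sum_permutations_prod_predictor_le)
  finally show ?thesis .
qed

lemma sum_permutations_conformal_e_test_le:
  assumes "conformal_e_test M N E" and z: "z \<in> space (seqs M N)"
  shows "(\<Sum>\<pi> | \<pi> permutes {..<N}. E (permute_seq N \<pi> z)) \<le> fact N"
proof -
  obtain k :: nat and w and F :: "nat \<Rightarrow> (nat \<Rightarrow> 'a) \<Rightarrow> real"
    where F: "\<And>i. i \<in> {1..k} \<Longrightarrow> w i \<in> {0..1} \<and> basic_conformal_e_test M N (F i)"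
    and w: "(\<Sum>i=1..k. w i) = 1"
    and E: "\<And>z. z \<in> space (seqs M N) \<Longrightarrow> E z = (\<Sum>i=1..k. w i * F i z)"
    using assms unfolding conformal_e_test_def by blast
  have "(\<Sum>\<pi> | \<pi> permutes {..<N}. E (permute_seq N \<pi> z)) =
      (\<Sum>\<pi> | \<pi> permutes {..<N}. \<Sum>i=1..k. w i * F i (permute_seq N \<pi> z))"
    using z measurable_space[OF measurable_permute_seq]
    by (intro sum.cong refl E) blast
  also have "\<dots> = (\<Sum>i=1..k. w i * (\<Sum>\<pi> | \<pi> permutes {..<N}. F i (permute_seq N \<pi> z)))"
    unfolding sum_distrib_left by (rule sum.swap)
  also have "\<dots> \<le> (\<Sum>i=1..k. w i * fact N)"
    using F sum_permutations_basic_conformal_e_test_le[OF _ z]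
    by (intro sum_mono mult_left_mono) auto
  also have "\<dots> = fact N"
    using w by (simp flip: sum_distrib_right)
  finally show ?thesis .
qed

section \<open>Exchangeable probability of an event on which a test is large\<close>

lemma exchangeable_measure_le:
  assumes P: "exchangeable M N P" and A: "A \<in> sets (seqs M N)"
    and E: "conformal_e_test M N E" and "\<alpha> > 0" and ge: "\<And>z. z \<in> A \<Longrightarrow> E z \<ge> 1 / \<alpha>"
  shows "measure P A \<le> \<alpha>"
proof -
  interpret prob_space P
    using P by (simp add: exchangeable_def)
  have sets_P [measurable_cong]: "sets P = sets (seqs M N)"
    using P by (simp add: exchangeable_def)
  have space_P: "space P = space (seqs M N)"
    using sets_P by (rule sets_eq_imp_space_eq)
  let ?S = "{\<pi>. \<pi> permutes {..<N}}"
  let ?C = "\<lambda>\<pi>. permute_seq N \<pi> -` A \<inter> space P"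
  have meas: "permute_seq N \<pi> \<in> P \<rightarrow>\<^sub>M seqs M N" if "\<pi> \<in> ?S" for \<pi>
    using measurable_permute_seq[of \<pi> N M] that by (simp cong: measurable_cong_sets add: sets_P)
  have C: "?C \<pi> \<in> sets P" if "\<pi> \<in> ?S" for \<pi>
    using measurable_sets[OF meas[OF that] A] .
  have "measure P (?C \<pi>) = measure P A" if "\<pi> \<in> ?S" for \<pi>
  proof -
    have "distr P (seqs M N) (permute_seq N \<pi>) = P"
      using P that by (simp add: exchangeable_def)
    then show ?thesis
      using measure_distr[OF meas[OF that] A] by simp
  qed
  \<comment> \<open>Summed over all permutations, the indicators count those that carry
    \<open>z\<close> into \<open>A\<close>. By exchangeability this count has expectation
    \<open>fact N * measure P A\<close>.\<close>
  then have "fact N * measure P A = (\<Sum>\<pi>\<in>?S. measure P (?C \<pi>))"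
    by (simp add: card_permutations[where n = N])
  also have "\<dots> = (\<Sum>\<pi>\<in>?S. \<integral>z. indicator (?C \<pi>) z \<partial>P)"
    using C by (intro sum.cong refl) simp
  also have "\<dots> = (\<integral>z. (\<Sum>\<pi>\<in>?S. indicator (?C \<pi>) z) \<partial>P)"
    using C by (intro Bochner_Integration.integral_sum[symmetric]) (simp add: less_top[symmetric])
  also have "\<dots> \<le> (\<integral>z. \<alpha> * fact N \<partial>P)"
  proof (rule integral_mono)
    show "integrable P (\<lambda>z. \<Sum>\<pi>\<in>?S. indicator (?C \<pi>) z :: real)"
      using C by (intro Bochner_Integration.integrable_sum) (simp add: less_top[symmetric])
    fix z assume "z \<in> space P"
    then have z: "z \<in> space (seqs M N)"
      by (simp add: space_P)
    \<comment> \<open>This is the Markov inequality in pointwise form, so that only indicators of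
      measurable sets have to be integrated.\<close>
    have "indicator (?C \<pi>) z \<le> \<alpha> * E (permute_seq N \<pi> z)" if "\<pi> \<in> ?S" for \<pi>
    proof (cases "permute_seq N \<pi> z \<in> A")
      case True
      then show ?thesis
        using ge[OF True] \<open>\<alpha> > 0\<close> by (simp add: field_simps indicator_def)
    next
      case False
      have "permute_seq N \<pi> z \<in> space (seqs M N)"
        using measurable_space[OF measurable_permute_seq z] that by auto
      then show ?thesis
        using False conformal_e_test_nonneg[OF E] \<open>\<alpha> > 0\<close> by simp
    qed
    then have "(\<Sum>\<pi>\<in>?S. indicator (?C \<pi>) z) \<le> (\<Sum>\<pi>\<in>?S. \<alpha> * E (permute_seq N \<pi> z))"
      by (rule sum_mono)
    also have "\<dots> = \<alpha> * (\<Sum>\<pi>\<in>?S. E (permute_seq N \<pi> z))"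
      by (simp add: sum_distrib_left)
    also have "\<dots> \<le> \<alpha> * fact N"
      using sum_permutations_conformal_e_test_le[OF E z] \<open>\<alpha> > 0\<close> by simp
    finally show "(\<Sum>\<pi>\<in>?S. indicator (?C \<pi>) z) \<le> \<alpha> * fact N" .
  qed simp
  finally have "fact N * measure P A \<le> fact N * \<alpha>"
    by (simp add: prob_space mult.commute)
  then show ?thesis
    by simp
qed

section \<open>Constant tests and convex combinations\<close>

lemma basic_conformal_e_test_one: "basic_conformal_e_test M N (\<lambda>_. 1)"
proof -
  let ?B = "\<lambda>m _. \<lambda>i\<in>{..<m}. 1 :: real"
  have "nonconformity_e_measure M ?B"
    unfolding nonconformity_e_measure_def
  proof (intro allI impI conjI ballI)
    fix m :: nat
    show "?B m \<in> seqs M m \<rightarrow>\<^sub>M seqs (restrict_space borel {0..}) m"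
      by (intro measurable_const) (auto simp: space_PiM space_restrict_space)
    fix z :: "nat \<Rightarrow> 'a" and \<pi> assume "\<pi> permutes {..<m}"
    then show "?B m (permute_seq m \<pi> z) = permute_seq m \<pi> (?B m z)"
      using permutes_in_image[of \<pi> "{..<m}"] by (auto simp: permute_seq_def fun_eq_iff)
  qed simp
  then have "conformal_e_predictor M (\<lambda>_ _. 1)"
    unfolding conformal_e_predictor_def by (intro exI[of _ ?B]) auto
  then show ?thesis
    unfolding basic_conformal_e_test_def by (intro exI[of _ "\<lambda>_ _. 1"]) auto
qed

text \<open>The missing weight goes to the constant test 1, which is itself basic. This allows
  weights that add up to less than 1 and an arbitrary finite index set, such as the event
  \<open>A\<close> in the upper bound.\<close>

lemma conformal_e_test_subconvex:
  assumes "finite I" "\<And>i. i \<in> I \<Longrightarrow> w i \<ge> 0" "sum w I \<le> 1"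
    and "\<And>i. i \<in> I \<Longrightarrow> basic_conformal_e_test M N (F i)"
  shows "conformal_e_test M N (\<lambda>z. (\<Sum>i\<in>I. w i * F i z) + (1 - sum w I))"
proof -
  obtain h where h: "bij_betw h {1..card I} I"
    using ex_bij_betw_nat_finite_1[OF assms(1)] by blast
  \<comment> \<open>The indices up to \<open>card I\<close> enumerate \<open>I\<close>; the
    additional last index \<open>k\<close> carries the constant test.\<close>
  define k where "k = Suc (card I)"
  define w' where "w' i = (if i = k then 1 - sum w I else w (h i))" for i
  define F' where "F' i = (if i = k then \<lambda>_. 1 else F (h i))" for i
  have reindex: "(\<Sum>i=1..card I. g (h i)) = sum g I" for g :: "_ \<Rightarrow> real"
    using sum.reindex_bij_betw[OF h] .
  have hI: "h i \<in> I" if "i \<in> {1..k}" "i \<noteq> k" for i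
    using that bij_betwE[OF h] by (auto simp: k_def)
  have "w i \<le> 1" if "i \<in> I" for i
    using member_le_sum[OF that, of w] assms(1-3) by fastforce
  then have "\<forall>i\<in>{1..k}. w' i \<in> {0..1} \<and> basic_conformal_e_test M N (F' i)"
    using hI assms(2-4) basic_conformal_e_test_one by (auto simp: w'_def F'_def sum_nonneg)
  moreover have "(\<Sum>i=1..k. w' i) = 1"
    using reindex[of w] by (simp add: w'_def k_def)
  moreover have "(\<Sum>i\<in>I. w i * F i z) + (1 - sum w I) = (\<Sum>i=1..k. w' i * F' i z)" for z
    using reindex[of "\<lambda>i. w i * F i z"] by (simp add: w'_def F'_def k_def)
  moreover have "k \<ge> 1"
    by (simp add: k_def)
  ultimately show ?thesis
    unfolding conformal_e_test_def
    by (intro exI[of _ k] exI[of _ w'] exI[of _ F'] conjI ballI) simp_all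
qed

lemma conformal_e_test_one: "conformal_e_test M N (\<lambda>_. 1)"
  using conformal_e_test_subconvex[of "{}"] by simp

section \<open>The two upper probabilities and the lower bound\<close>

lemma upper_ce_prob_le:
  assumes "conformal_e_test M N E" "\<alpha> > 0" "\<And>z. z \<in> A \<Longrightarrow> E z \<ge> 1 / \<alpha>"
  shows "upper_ce_prob M N A \<le> \<alpha>"
  unfolding upper_ce_prob_def using assms
  by (intro cInf_lower bdd_belowI[of _ 0]) auto

lemma upper_exch_prob_ge:
  assumes "exchangeable M N P"
  shows "measure P A \<le> upper_exch_prob M N A"
  unfolding upper_exch_prob_def using assms
  by (intro cSUP_upper bdd_aboveI2[of _ _ 1])
     (auto simp: exchangeable_def intro: prob_space.prob_le_1)

lemma exchangeable_return_const:
  assumes "c \<in> space M"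
  shows "exchangeable M N (return (seqs M N) (\<lambda>i\<in>{..<N}. c))"
proof -
  let ?x = "\<lambda>i\<in>{..<N}. c"
  have x: "?x \<in> space (seqs M N)"
    using assms by (auto simp: space_PiM)
  have "distr (return (seqs M N) ?x) (seqs M N) (permute_seq N \<pi>) = return (seqs M N) ?x"
    if "\<pi> permutes {..<N}" for \<pi>
  proof -
    have "permute_seq N \<pi> ?x = ?x"
      using permutes_in_image[OF that] by (auto simp: permute_seq_def fun_eq_iff)
    then show ?thesis
      using distr_return[OF measurable_permute_seq[OF that] x] by simp
  qed
  then show ?thesis
    using prob_space_return[OF x] by (simp add: exchangeable_def)
qed

lemma upper_exch_prob_le_upper_ce_prob:
  assumes "space M \<noteq> {}" "A \<in> sets (seqs M N)"
  shows "upper_exch_prob M N A \<le> upper_ce_prob M N A"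
proof -
  \<comment> \<open>Comparing a real infimum and a real supremum with a bound requires nonempty
    sets: the constant test supplies 1 for the infimum, and a point mass at a constant sequence
    supplies a measure for the supremum below.\<close>
  have "1 \<in> {\<alpha>. \<alpha> > 0 \<and> (\<exists>E. conformal_e_test M N E \<and> (\<forall>z\<in>A. E z \<ge> 1 / \<alpha>))}"
    using conformal_e_test_one by force
  then have "measure P A \<le> upper_ce_prob M N A" if "exchangeable M N P" for P
    unfolding upper_ce_prob_def using exchangeable_measure_le[OF that assms(2)]
    by (intro cInf_greatest) blast+
  moreover have "\<exists>P. exchangeable M N P"
    using assms(1) exchangeable_return_const[of _ M N] by blast
  ultimately show ?thesis
    unfolding upper_exch_prob_def by (intro cSUP_least) auto
qed

section \<open>Exchangeability over a finite alphabet\<close>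

lemma seqs_count_space:
  assumes "finite X"
  shows "seqs (count_space X) N = count_space ({..<N} \<rightarrow>\<^sub>E X)"
  using assms by (intro count_space_PiM_finite) (auto intro: countable_finite)

lemma permute_seq_compose:
  assumes "\<pi> permutes {..<m}"
  shows "permute_seq m \<pi> (permute_seq m \<sigma> z) = permute_seq m (\<sigma> \<circ> \<pi>) z"
  using permutes_in_image[OF assms] by (auto simp: permute_seq_def fun_eq_iff)

text \<open>Extensionality enters because \<open>permute_seq\<close> makes the values outside
  \<open>{..<m}\<close> undefined, so that only extensional sequences can be recovered.\<close>

lemma permute_seq_inverses:
  assumes "\<pi> permutes {..<m}" "z \<in> extensional {..<m}"
  shows "permute_seq m \<pi> (permute_seq m (inv \<pi>) z) = z"
    and "permute_seq m (inv \<pi>) (permute_seq m \<pi> z) = z"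
proof -
  have "permute_seq m id z = z"
    using extensional_restrict[OF assms(2)] by (simp add: permute_seq_def)
  then show "permute_seq m \<pi> (permute_seq m (inv \<pi>) z) = z"
    and "permute_seq m (inv \<pi>) (permute_seq m \<pi> z) = z"
    using assms(1) by (simp_all add: permute_seq_compose permutes_inv permutes_inv_o)
qed

text \<open>A permutation acts on the invariant set \<open>U\<close> as a bijection, with the
  inverse permutation as its inverse. Hence the preimage of any \<open>S\<close> meets
  \<open>U\<close> in as many points as \<open>S\<close> does, and the uniform distribution gives
  both the same mass.\<close>

lemma exchangeable_uniform_measure:
  assumes X: "finite X" and U: "U \<subseteq> {..<N} \<rightarrow>\<^sub>E X" "U \<noteq> {}"
    and inv: "\<And>\<pi> z. \<pi> permutes {..<N} \<Longrightarrow> z \<in> U \<Longrightarrow> permute_seq N \<pi> z \<in> U"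
  shows "exchangeable (count_space X) N (uniform_measure (seqs (count_space X) N) U)"
proof -
  let ?Q = "seqs (count_space X) N"
  let ?P = "uniform_measure ?Q U"
  have fin: "finite ({..<N} \<rightarrow>\<^sub>E X)"
    using X by (intro finite_PiE) auto
  have finU: "finite U"
    using fin U(1) by (rule finite_subset[rotated])
  note Q = seqs_count_space[OF X, of N]
  have emeasure_P: "emeasure ?P S = ennreal (card (U \<inter> S)) / ennreal (card U)"
    if "S \<subseteq> {..<N} \<rightarrow>\<^sub>E X" for S
    using that U(1) finU
    by (simp add: Q emeasure_count_space ennreal_of_nat_eq_real_of_nat le_infI1)
  have "prob_space ?P"
    using U finU by (intro prob_space_uniform_measure) (auto simp: Q emeasure_count_space)
  moreover have "distr ?P ?Q (permute_seq N \<pi>) = ?P" if \<pi>: "\<pi> permutes {..<N}" for \<pi>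
  proof (rule measure_eqI)
    fix S assume "S \<in> sets (distr ?P ?Q (permute_seq N \<pi>))"
    then have S: "S \<in> sets ?Q" "S \<subseteq> {..<N} \<rightarrow>\<^sub>E X"
      by (auto simp: Q)
    let ?S' = "permute_seq N \<pi> -` S \<inter> ({..<N} \<rightarrow>\<^sub>E X)"
    have inverses: "permute_seq N \<pi> (permute_seq N (inv \<pi>) z) = z"
        "permute_seq N (inv \<pi>) (permute_seq N \<pi> z) = z" if "z \<in> U" for z
      using permute_seq_inverses[OF \<pi>, of z] that U(1) by (auto simp: PiE_def)
    have "bij_betw (permute_seq N \<pi>) (U \<inter> ?S') (U \<inter> S)"
      using inv[OF \<pi>] inv[OF permutes_inv[OF \<pi>]]
      by (intro bij_betw_byWitness[where f' = "permute_seq N (inv \<pi>)"])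
         (auto simp: inverses dest: subsetD[OF U(1)])
    then have card_eq: "card (U \<inter> ?S') = card (U \<inter> S)"
      by (rule bij_betw_same_card)
    have "permute_seq N \<pi> \<in> ?P \<rightarrow>\<^sub>M ?Q"
      using measurable_permute_seq[OF \<pi>, of "count_space X"]
      by (simp cong: measurable_cong_sets)
    then have "emeasure (distr ?P ?Q (permute_seq N \<pi>)) S = emeasure ?P ?S'"
      using S(1) by (simp add: emeasure_distr space_PiM)
    also have "\<dots> = emeasure ?P S"
      using S(2) card_eq by (simp add: emeasure_P)
    finally show "emeasure (distr ?P ?Q (permute_seq N \<pi>)) S = emeasure ?P S" .
  qed simp
  ultimately show ?thesis
    by (simp add: exchangeable_def)
qed

section \<open>Occurrence counts and tests that guess a fixed sequence\<close>

definition occ :: "nat \<Rightarrow> (nat \<Rightarrow> 'a) \<Rightarrow> 'a \<Rightarrow> nat" where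
  "occ m z x = card {i. i < m \<and> z i = x}"

lemma occ_permute_seq:
  assumes "\<pi> permutes {..<m}"
  shows "occ m (permute_seq m \<pi> z) x = occ m z x"
proof -
  have "bij_betw \<pi> {i. i < m \<and> permute_seq m \<pi> z i = x} {i. i < m \<and> z i = x}"
    using permutes_in_image[OF assms] permutes_in_image[OF permutes_inv[OF assms]]
      permutes_inverses[OF assms]
    by (intro bij_betw_byWitness[where f' = "inv \<pi>"]) (auto simp: permute_seq_def)
  then show ?thesis
    unfolding occ_def by (rule bij_betw_same_card)
qed

lemma occ_restrict: "occ m (restrict z {..<m}) x = occ m z x"
  unfolding occ_def by (intro arg_cong[where f = card]) auto

lemma occ_Suc: "occ (Suc m) z x = occ m z x + (if z m = x then 1 else 0)"
proof -
  have "{i. i < Suc m \<and> z i = x} = {i. i < m \<and> z i = x} \<union> (if z m = x then {m} else {})"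
    by (auto simp: less_Suc_eq)
  then show ?thesis
    by (auto simp: occ_def)
qed

text \<open>The total score \<open>m\<close> is shared equally by the positions holding
  \<open>a (m - 1)\<close>, the symbol guessed for the last place. The mean score is therefore 1 if
  that symbol occurs and 0 otherwise, and equivariance holds because counts are invariant under
  permutations. The quotient is used only at positions holding the symbol, where its count is
  positive.\<close>

definition guess_measure :: "(nat \<Rightarrow> 'a) \<Rightarrow> nat \<Rightarrow> (nat \<Rightarrow> 'a) \<Rightarrow> nat \<Rightarrow> real" where
  "guess_measure a m z = (\<lambda>i\<in>{..<m}. if z i = a (m - 1) then m / occ m z (a (m - 1)) else 0)"

definition guess_test :: "nat \<Rightarrow> (nat \<Rightarrow> 'a) \<Rightarrow> (nat \<Rightarrow> 'a) \<Rightarrow> real" where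
  "guess_test N a z =
     (\<Prod>n=1..N. if z (n - 1) = a (n - 1) then n / occ n z (a (n - 1)) else 0)"

lemma nonconformity_e_measure_guess_measure:
  assumes "finite X"
  shows "nonconformity_e_measure (count_space X) (guess_measure a)"
  unfolding nonconformity_e_measure_def
proof (intro allI impI conjI ballI)
  fix m :: nat assume "m \<ge> 1"
  show "guess_measure a m \<in> seqs (count_space X) m \<rightarrow>\<^sub>M seqs (restrict_space borel {0..}) m"
    unfolding seqs_count_space[OF assms]
    by (auto simp: guess_measure_def space_PiM space_restrict_space)
  fix z :: "nat \<Rightarrow> 'a"
  have "(\<Sum>i<m. guess_measure a m z i) =
      (\<Sum>i | i < m \<and> z i = a (m - 1). m / occ m z (a (m - 1)))"
    unfolding guess_measure_def by (intro sum.mono_neutral_cong_right) auto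
  also have "\<dots> \<le> m"
    by (simp add: occ_def)
  finally show "(1 / real m) * (\<Sum>i<m. guess_measure a m z i) \<le> 1"
    using \<open>m \<ge> 1\<close> by (simp add: field_simps)
  fix \<pi> assume \<pi>: "\<pi> permutes {..<m}"
  show "guess_measure a m (permute_seq m \<pi> z) = permute_seq m \<pi> (guess_measure a m z)"
    using permutes_in_image[OF \<pi>] occ_permute_seq[OF \<pi>, of z]
    by (auto simp: guess_measure_def permute_seq_def fun_eq_iff)
qed

lemma basic_conformal_e_test_guess_test:
  assumes "finite X"
  shows "basic_conformal_e_test (count_space X) N (guess_test N a)"
proof -
  let ?f = "\<lambda>m z. guess_measure a m z (m - 1)"
  have "conformal_e_predictor (count_space X) ?f"
    unfolding conformal_e_predictor_def
    using nonconformity_e_measure_guess_measure[OF assms] by blast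
  moreover have "guess_test N a z = (\<Prod>n=1..N. ?f n (restrict z {..<n}))" for z
    unfolding guess_test_def by (intro prod.cong refl) (auto simp: guess_measure_def occ_restrict)
  ultimately show ?thesis
    unfolding basic_conformal_e_test_def by blast
qed

text \<open>Appending a symbol raises its count by one, and the raised count is both the new factor
  of the product and the factor that turns the factorial of the old count into that of the new
  one.\<close>

lemma
  assumes "\<And>i. i < N \<Longrightarrow> a i \<in> {0, 1::nat}"
  shows occ_binary: "occ N a 0 + occ N a 1 = N"
    and prod_occ_binary: "(\<Prod>n=1..N. occ n a (a (n - 1))) = fact (occ N a 0) * fact (occ N a 1)"
proof -
  have "occ N a 0 + occ N a 1 = N \<and>
    (\<Prod>n=1..N. occ n a (a (n - 1))) = fact (occ N a 0) * fact (occ N a 1)"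
    using assms
  proof (induction N)
    case 0
    then show ?case by (simp add: occ_def)
  next
    case (Suc N)
    have IH: "occ N a 0 + occ N a 1 = N"
        "(\<Prod>n=1..N. occ n a (a (n - 1))) = fact (occ N a 0) * fact (occ N a 1)"
      using Suc.IH Suc.prems less_SucI by blast+
    have "a N = 0 \<or> a N = 1"
      using Suc.prems[of N] by simp
    then show ?case
      using IH by (elim disjE) (simp_all add: occ_Suc algebra_simps)
  qed
  then show "occ N a 0 + occ N a 1 = N"
    and "(\<Prod>n=1..N. occ n a (a (n - 1))) = fact (occ N a 0) * fact (occ N a 1)"
    by auto
qed

text \<open>Along \<open>a\<close> itself every guess is right, so no factor vanishes: the
  numerators multiply to \<open>fact N\<close> and the denominators to the factorials of the numbers
  of zeros and ones.\<close>

lemma guess_test_self: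
  assumes a: "\<And>i. i < N \<Longrightarrow> a i \<in> {0, 1::nat}"
  shows "guess_test N a a = N choose occ N a 1"
proof -
  have "guess_test N a a = (\<Prod>n=1..N. real n) / real (\<Prod>n=1..N. occ n a (a (n - 1)))"
    by (simp add: guess_test_def prod_dividef)
  also have "(\<Prod>n=1..N. real n) = fact N"
    by (simp add: fact_prod)
  also have "fact N / real (\<Prod>n=1..N. occ n a (a (n - 1))) = N choose occ N a 1"
  proof -
    have "occ N a 0 = N - occ N a 1" "occ N a 1 \<le> N"
      using occ_binary[of N a, OF a] by simp_all
    then show ?thesis
      using binomial_fact[of "occ N a 1" N, where 'a = real] prod_occ_binary[of N a, OF a]
      by (simp add: mult.commute del: of_nat_prod)
  qed
  finally show ?thesis .
qed

section \<open>Binary sequences with a given number of ones\<close>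

text \<open>For \<open>k \<le> N\<close> this is an orbit of the permutation action on binary
  sequences, called a type class in information theory.\<close>

definition binary_type :: "nat \<Rightarrow> nat \<Rightarrow> (nat \<Rightarrow> nat) set" where
  "binary_type N k = {z \<in> {..<N} \<rightarrow>\<^sub>E {0, 1}. occ N z 1 = k}"

text \<open>A binary sequence is determined by the set of positions of its ones.\<close>

lemma card_binary_type: "card (binary_type N k) = N choose k"
proof -
  have "bij_betw (\<lambda>z. {i. i < N \<and> z i = 1}) (binary_type N k)
      {S. S \<subseteq> {..<N} \<and> card S = k}"
  proof (rule bij_betw_byWitness[where f' = "\<lambda>S. \<lambda>i\<in>{..<N}. of_bool (i \<in> S)"])
    show "\<forall>z\<in>binary_type N k. (\<lambda>i\<in>{..<N}. of_bool (i \<in> {i. i < N \<and> z i = 1})) = z"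
      by (fastforce simp: binary_type_def fun_eq_iff PiE_iff extensional_def)
    have *: "{i. i < N \<and> (\<lambda>i\<in>{..<N}. of_bool (i \<in> S)) i = (1::nat)} = S"
      if "S \<subseteq> {..<N}" for S
      using that by auto
    then show "\<forall>S\<in>{S. S \<subseteq> {..<N} \<and> card S = k}.
        {i. i < N \<and> (\<lambda>i\<in>{..<N}. of_bool (i \<in> S)) i = (1::nat)} = S"
      by blast
    show "(\<lambda>S. \<lambda>i\<in>{..<N}. of_bool (i \<in> S)) ` {S. S \<subseteq> {..<N} \<and> card S = k}
        \<subseteq> binary_type N k"
      using * by (auto simp: binary_type_def occ_def split: if_splits)
  qed (auto simp: binary_type_def occ_def)
  then have "card (binary_type N k) = card {S. S \<subseteq> {..<N} \<and> card S = k}"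
    by (rule bij_betw_same_card)
  then show ?thesis
    using n_subsets[of "{..<N}" k] by simp
qed

text \<open>The uniform distribution on the type class is exchangeable, so it competes in the
  supremum, and it gives \<open>A\<close> the proportion of the class that lies in \<open>A\<close>.
  The condition \<open>k \<le> N\<close> makes the class nonempty.\<close>

lemma card_binary_type_le_upper_exch_prob:
  assumes "A \<subseteq> {..<N} \<rightarrow>\<^sub>E {0, 1}" "k \<le> N"
  shows "card (A \<inter> binary_type N k) \<le> (N choose k) * upper_exch_prob (count_space {0, 1}) N A"
proof -
  let ?M = "count_space {0, 1::nat}"
  let ?U = "binary_type N k"
  have fin: "finite ({..<N} \<rightarrow>\<^sub>E {0, 1::nat})"
    by (intro finite_PiE) auto
  have U: "?U \<subseteq> {..<N} \<rightarrow>\<^sub>E {0, 1}"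
    by (auto simp: binary_type_def)
  have finU: "finite ?U"
    using U fin by (rule finite_subset)
  have pos: "N choose k > 0"
    using assms(2) by simp
  have ne: "?U \<noteq> {}"
    using pos card_binary_type[of N k] by force
  have "permute_seq N \<pi> z \<in> ?U" if "\<pi> permutes {..<N}" "z \<in> ?U" for \<pi> z
    using that measurable_space[OF measurable_permute_seq[OF that(1)], of z ?M]
    by (simp add: binary_type_def occ_permute_seq space_PiM)
  then have "exchangeable ?M N (uniform_measure (seqs ?M N) ?U)"
    using U ne by (intro exchangeable_uniform_measure) auto
  then have "measure (uniform_measure (seqs ?M N) ?U) A \<le> upper_exch_prob ?M N A"
    by (rule upper_exch_prob_ge)
  moreover have "measure (uniform_measure (seqs ?M N) ?U) A =
      card (A \<inter> ?U) / (N choose k)"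
  proof -
    have "measure (seqs ?M N) S = card S" if "S \<subseteq> {..<N} \<rightarrow>\<^sub>E {0, 1}" for S
      using that finite_subset[OF that fin]
      by (simp add: seqs_count_space measure_count_space)
    moreover have "emeasure (seqs ?M N) ?U \<noteq> 0" "emeasure (seqs ?M N) ?U \<noteq> \<infinity>"
      using U finU ne by (simp_all add: seqs_count_space emeasure_count_space)
    ultimately show ?thesis
      using assms(1) U by (simp add: seqs_count_space card_binary_type Int_commute le_infI1)
  qed
  ultimately show ?thesis
    using pos by (simp add: field_simps)
qed

section \<open>The upper bound for binary sequences\<close>

lemma binary_upper_ce_prob_le_upper_exch_prob:
  fixes A :: "(nat \<Rightarrow> nat) set"
  assumes "N \<ge> 1" and A: "A \<subseteq> {..<N} \<rightarrow>\<^sub>E {0, 1}"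
  shows "upper_ce_prob (count_space {0, 1}) N A \<le> N * upper_exch_prob (count_space {0, 1}) N A"
proof -
  let ?M = "count_space {0, 1::nat}"
  define p where "p = upper_exch_prob ?M N A"
  have finA: "finite A"
    using A by (rule finite_subset) (intro finite_PiE, auto)
  have class_le: "card (A \<inter> binary_type N k) \<le> (N choose k) * p" if "k \<le> N" for k
    unfolding p_def using A that by (rule card_binary_type_le_upper_exch_prob)
  have binary: "a i \<in> {0, 1}" if "a \<in> A" "i < N" for a i
    using PiE_mem[OF subsetD[OF A that(1)], of i] that(2) by simp
  have occ_le: "occ N a 1 \<le> N" if "a \<in> A" for a
  proof -
    have "occ N a 0 + occ N a 1 = N"
      using binary[OF that] by (rule occ_binary)
    then show ?thesis
      by simp
  qed
  have class_eq: "A \<inter> binary_type N k = {a \<in> A. occ N a 1 = k}" for k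
    using A unfolding binary_type_def by blast
  \<comment> \<open>Positivity of \<open>p\<close> makes \<open>N * p\<close> an admissible value of
    \<open>\<alpha>\<close> and a legitimate denominator for the weights.\<close>
  have p_pos: "p > 0" if "a \<in> A" for a
  proof -
    have "a \<in> A \<inter> binary_type N (occ N a 1)"
      using that by (simp add: class_eq)
    then have "0 < real (card (A \<inter> binary_type N (occ N a 1)))"
      using finA by (auto simp: card_gt_0_iff)
    also have "\<dots> \<le> (N choose occ N a 1) * p"
      using class_le occ_le[OF that] by blast
    finally show ?thesis
      by (simp add: zero_less_mult_iff)
  qed
  consider "A = {}" | a where "a \<in> A" "occ N a 1 = 0"
    | "A \<noteq> {}" "\<And>a. a \<in> A \<Longrightarrow> occ N a 1 \<noteq> 0"
    by blast
  then have "upper_ce_prob ?M N A \<le> N * p"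
  proof cases
    case 1
    have "p \<ge> 0"
      using class_le[of 0] by simp
    \<comment> \<open>For empty \<open>A\<close> the condition on the test is vacuous, so every
      positive \<open>\<alpha>\<close> is admissible and the infimum is at most 0.\<close>
    have "upper_ce_prob ?M N A \<le> \<alpha>" if "\<alpha> > 0" for \<alpha>
      using 1 by (intro upper_ce_prob_le[OF conformal_e_test_one that]) simp
    then have "upper_ce_prob ?M N A \<le> 0"
      by (rule field_le_epsilon) simp
    then show ?thesis
      using \<open>p \<ge> 0\<close> by (smt (verit) mult_nonneg_nonneg of_nat_0_le_iff)
  next
    case 2
    \<comment> \<open>The class without ones consists of a single sequence, since
      \<open>N choose 0 = 1\<close>. If it meets \<open>A\<close>, the bound on its share forces
      \<open>p\<close> to be at least 1.\<close>
    have "a \<in> A \<inter> binary_type N 0"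
      using 2 by (simp add: class_eq)
    then have "1 \<le> card (A \<inter> binary_type N 0)"
      using finA by (auto simp: Suc_le_eq card_gt_0_iff)
    then have "1 \<le> p"
      using class_le[of 0] by simp
    moreover have "upper_ce_prob ?M N A \<le> 1"
      using conformal_e_test_one by (rule upper_ce_prob_le) auto
    moreover have "p \<le> N * p"
      using \<open>1 \<le> p\<close> \<open>N \<ge> 1\<close> by (simp add: mult_le_cancel_right1)
    ultimately show ?thesis
      by linarith
  next
    case 3
    have "p > 0"
      using p_pos 3(1) by blast
    \<comment> \<open>Each of the \<open>N\<close> classes with 1 to \<open>N\<close> ones gets a
      budget of \<open>1 / N\<close>. Class \<open>k\<close> has at most
      \<open>p * (N choose k)\<close> members in \<open>A\<close>, and dividing its budget by this
      bound gives the weight of one member.\<close>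
    let ?w = "\<lambda>a. 1 / (N * p * (N choose occ N a 1))"
    have range: "occ N a 1 \<in> {1..N}" if "a \<in> A" for a
      using 3(2)[OF that] occ_le[OF that] by simp
    have "sum ?w A = (\<Sum>k\<in>{1..N}. \<Sum>a | a \<in> A \<and> occ N a 1 = k. ?w a)"
      using finA range by (intro sum.group[symmetric]) auto
    also have "\<dots> = (\<Sum>k\<in>{1..N}. card (A \<inter> binary_type N k) / (N * p * (N choose k)))"
      by (intro sum.cong refl) (simp add: class_eq)
    also have "\<dots> \<le> (\<Sum>k\<in>{1..N}. 1 / N)"
      using class_le \<open>p > 0\<close> \<open>N \<ge> 1\<close>
      by (intro sum_mono) (simp add: field_simps)
    finally have w_le: "sum ?w A \<le> 1"
      using \<open>N \<ge> 1\<close> by simp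
    let ?E = "\<lambda>z. (\<Sum>a\<in>A. ?w a * guess_test N a z) + (1 - sum ?w A)"
    have "conformal_e_test ?M N ?E"
      using finA w_le \<open>p > 0\<close>
      by (intro conformal_e_test_subconvex basic_conformal_e_test_guess_test) auto
    moreover have "?E a \<ge> 1 / (N * p)" if "a \<in> A" for a
    proof -
      have "guess_test N a a = N choose occ N a 1"
        using binary[OF that] by (rule guess_test_self)
      \<comment> \<open>The binomial coefficient in the weight cancels the value of the test, so the
        term of \<open>a\<close> alone reaches the target; all other terms are nonnegative.\<close>
      then have "1 / (N * p) = ?w a * guess_test N a a"
        using occ_le[OF that] by simp
      also have "\<dots> \<le> (\<Sum>b\<in>A. ?w b * guess_test N b a)"
        using that finA \<open>p > 0\<close>
        by (intro member_le_sum[where f = "\<lambda>b. ?w b * guess_test N b a"])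
           (auto simp: guess_test_def intro!: mult_nonneg_nonneg divide_nonneg_nonneg prod_nonneg)
      finally show ?thesis
        using w_le by simp
    qed
    ultimately show ?thesis
      using \<open>p > 0\<close> \<open>N \<ge> 1\<close> by (intro upper_ce_prob_le) auto
  qed
  then show ?thesis
    by (simp add: p_def)
qed

theorem proposition4:
  fixes M :: "'a measure" and N :: nat
  assumes "space M \<noteq> {}" and "N \<ge> 1"
  shows "(\<forall>A\<in>sets (seqs M N). upper_exch_prob M N A \<le> upper_ce_prob M N A) \<and>
         (\<forall>A. A \<subseteq> space (seqs (count_space {0, 1::nat}) N) \<longrightarrow>
            upper_ce_prob (count_space {0, 1::nat}) N A
              \<le> real N * upper_exch_prob (count_space {0, 1::nat}) N A)"
  using upper_exch_prob_le_upper_ce_prob[OF assms(1)]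
    binary_upper_ce_prob_le_upper_exch_prob[OF assms(2)]
  unfolding space_PiM space_count_space by blast

end
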